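(* Let $\rho$ and $\tau$ be polymorphic types (types of System $\mathbf F$). If $\rho\trianglelefteq\tau$ then $FV(\rho)\subseteq FV(\tau)$.
   Context: Types of System $\mathbf F$ are built from type variables with $\to$ and $\forall$; $FV(\sigma)$ is the set of free type variables of $\sigma$. Terms are Church-style System $\mathbf F$ terms, with type abstraction $\Lambda a.M$ and type application $M\sigma$, and $=_{\beta\eta}$ is $\beta\eta$-equality (for both term and type abstraction/application). Retraction: $\rho\trianglelefteq\tau$ means that there are a type environment $E$ and terms $C$ (the coder), $D$ (the decoder) with $E,(x:\rho)\vdash C:\tau$, $E\vdash D:\tau\to\rho$, $x\notin FV(D)$, and $DC=_{\beta\eta}x$. The types of the free variables declared in $E$ are arbitrary. *)

theory Defs
  imports Main
begin

text \<open>
  Church-style System F with de Bruijn indices, so that alpha-equivalent types and terms are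
  equal. Type variables and term variables are indexed independently. An index that is not
  captured by a binder is a free variable: below \<open>k\<close> binders of its sort, the free variable \<open>n\<close>
  is written \<open>k + n\<close>.
\<close>

datatype ty =
    TVar nat
  | Arr ty ty  (infixr \<open>\<rightarrow>\<^sub>F\<close> 70)
  | All ty

datatype tm =
    Var nat
  | Lam ty tm
  | App tm tm
  | TLam tm
  | TApp tm ty

primrec FV_ty :: "ty \<Rightarrow> nat set" where
  "FV_ty (TVar n) = {n}"
| "FV_ty (\<sigma> \<rightarrow>\<^sub>F \<tau>) = FV_ty \<sigma> \<union> FV_ty \<tau>"
| "FV_ty (All \<sigma>) = {n. Suc n \<in> FV_ty \<sigma>}"

text \<open>Only term variables are collected here, not the type variables of annotations.\<close>

primrec FV_tm :: "tm \<Rightarrow> nat set" where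
  "FV_tm (Var n) = {n}"
| "FV_tm (Lam \<sigma> M) = {n. Suc n \<in> FV_tm M}"
| "FV_tm (App M N) = FV_tm M \<union> FV_tm N"
| "FV_tm (TLam M) = FV_tm M"
| "FV_tm (TApp M \<sigma>) = FV_tm M"


subsection \<open>Renaming and substitution\<close>

text \<open>
  All renamings and substitutions are simultaneous; \<open>up_ren\<close>, \<open>up_ty\<close>, \<open>up_tm\<close> extend them under
  a binder.
\<close>

definition up_ren :: "(nat \<Rightarrow> nat) \<Rightarrow> nat \<Rightarrow> nat" where
  "up_ren r = case_nat 0 (\<lambda>n. Suc (r n))"

primrec ren_ty :: "(nat \<Rightarrow> nat) \<Rightarrow> ty \<Rightarrow> ty" where
  "ren_ty r (TVar n) = TVar (r n)"
| "ren_ty r (\<sigma> \<rightarrow>\<^sub>F \<tau>) = ren_ty r \<sigma> \<rightarrow>\<^sub>F ren_ty r \<tau>"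
| "ren_ty r (All \<sigma>) = All (ren_ty (up_ren r) \<sigma>)"

definition up_ty :: "(nat \<Rightarrow> ty) \<Rightarrow> nat \<Rightarrow> ty" where
  "up_ty \<theta> = case_nat (TVar 0) (\<lambda>n. ren_ty Suc (\<theta> n))"

primrec subst_ty :: "(nat \<Rightarrow> ty) \<Rightarrow> ty \<Rightarrow> ty" where
  "subst_ty \<theta> (TVar n) = \<theta> n"
| "subst_ty \<theta> (\<sigma> \<rightarrow>\<^sub>F \<tau>) = subst_ty \<theta> \<sigma> \<rightarrow>\<^sub>F subst_ty \<theta> \<tau>"
| "subst_ty \<theta> (All \<sigma>) = All (subst_ty (up_ty \<theta>) \<sigma>)"

text \<open>In \<open>ren_tm q r\<close>, \<open>q\<close> renames type variables and \<open>r\<close> renames term variables.\<close>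

primrec ren_tm :: "(nat \<Rightarrow> nat) \<Rightarrow> (nat \<Rightarrow> nat) \<Rightarrow> tm \<Rightarrow> tm" where
  "ren_tm q r (Var n) = Var (r n)"
| "ren_tm q r (Lam \<sigma> M) = Lam (ren_ty q \<sigma>) (ren_tm q (up_ren r) M)"
| "ren_tm q r (App M N) = App (ren_tm q r M) (ren_tm q r N)"
| "ren_tm q r (TLam M) = TLam (ren_tm (up_ren q) r M)"
| "ren_tm q r (TApp M \<sigma>) = TApp (ren_tm q r M) (ren_ty q \<sigma>)"

definition up_tm :: "(nat \<Rightarrow> tm) \<Rightarrow> nat \<Rightarrow> tm" where
  "up_tm s = case_nat (Var 0) (\<lambda>n. ren_tm id Suc (s n))"

primrec subst_tm :: "(nat \<Rightarrow> ty) \<Rightarrow> (nat \<Rightarrow> tm) \<Rightarrow> tm \<Rightarrow> tm" where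
  "subst_tm \<theta> s (Var n) = s n"
| "subst_tm \<theta> s (Lam \<sigma> M) = Lam (subst_ty \<theta> \<sigma>) (subst_tm \<theta> (up_tm s) M)"
| "subst_tm \<theta> s (App M N) = App (subst_tm \<theta> s M) (subst_tm \<theta> s N)"
| "subst_tm \<theta> s (TLam M) = TLam (subst_tm (up_ty \<theta>) (\<lambda>n. ren_tm Suc id (s n)) M)"
| "subst_tm \<theta> s (TApp M \<sigma>) = TApp (subst_tm \<theta> s M) (subst_ty \<theta> \<sigma>)"

text \<open>
  Instantiation of the outermost bound variable (index 0) of a body: \<open>inst_ty \<tau> \<sigma>\<close> is \<open>\<tau>[\<sigma>/a]\<close>,
  \<open>inst_tm M N\<close> is \<open>M[N/x]\<close>, and \<open>inst_tm_ty M \<sigma>\<close> is \<open>M[\<sigma>/a]\<close>.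
\<close>

definition inst_ty :: "ty \<Rightarrow> ty \<Rightarrow> ty" where
  "inst_ty \<tau> \<sigma> = subst_ty (case_nat \<sigma> TVar) \<tau>"

definition inst_tm :: "tm \<Rightarrow> tm \<Rightarrow> tm" where
  "inst_tm M N = subst_tm TVar (case_nat N Var) M"

definition inst_tm_ty :: "tm \<Rightarrow> ty \<Rightarrow> tm" where
  "inst_tm_ty M \<sigma> = subst_tm (case_nat \<sigma> TVar) Var M"


subsection \<open>Typing\<close>

text \<open>
  An environment declares types for free term variables. Going under a \<open>TLam\<close> shifts all declared
  types, which is the usual side condition that the bound type variable is not free in the
  environment.
\<close>

type_synonym env = "nat \<rightharpoonup> ty"

definition push :: "ty \<Rightarrow> env \<Rightarrow> env" where
  "push \<sigma> E = case_nat (Some \<sigma>) E"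

definition shift_env :: "env \<Rightarrow> env" where
  "shift_env E = (\<lambda>n. map_option (ren_ty Suc) (E n))"

inductive typing :: "env \<Rightarrow> tm \<Rightarrow> ty \<Rightarrow> bool"  (\<open>_ \<turnstile> _ : _\<close> [50, 50, 50] 50) where
  T_Var: "E n = Some \<sigma> \<Longrightarrow> E \<turnstile> Var n : \<sigma>"
| T_Lam: "push \<sigma> E \<turnstile> M : \<tau> \<Longrightarrow> E \<turnstile> Lam \<sigma> M : \<sigma> \<rightarrow>\<^sub>F \<tau>"
| T_App: "E \<turnstile> M : \<sigma> \<rightarrow>\<^sub>F \<tau> \<Longrightarrow> E \<turnstile> N : \<sigma> \<Longrightarrow> E \<turnstile> App M N : \<tau>"
| T_TLam: "shift_env E \<turnstile> M : \<tau> \<Longrightarrow> E \<turnstile> TLam M : All \<tau>"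
| T_TApp: "E \<turnstile> M : All \<tau> \<Longrightarrow> E \<turnstile> TApp M \<sigma> : inst_ty \<tau> \<sigma>"


subsection \<open>Beta-eta equality\<close>

text \<open>
  The least congruence on (not necessarily typable) terms containing the beta and eta rules for
  both kinds of abstraction. In the eta rules the shifts express that the bound variable is not
  free in \<open>M\<close>.
\<close>

inductive beta_eta_eq :: "tm \<Rightarrow> tm \<Rightarrow> bool"  (infix \<open>=\<^sub>\<beta>\<^sub>\<eta>\<close> 50) where
  beta: "App (Lam \<sigma> M) N =\<^sub>\<beta>\<^sub>\<eta> inst_tm M N"
| tbeta: "TApp (TLam M) \<sigma> =\<^sub>\<beta>\<^sub>\<eta> inst_tm_ty M \<sigma>"
| eta: "Lam \<sigma> (App (ren_tm id Suc M) (Var 0)) =\<^sub>\<beta>\<^sub>\<eta> M"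
| teta: "TLam (TApp (ren_tm Suc id M) (TVar 0)) =\<^sub>\<beta>\<^sub>\<eta> M"
| refl: "M =\<^sub>\<beta>\<^sub>\<eta> M"
| sym: "M =\<^sub>\<beta>\<^sub>\<eta> N \<Longrightarrow> N =\<^sub>\<beta>\<^sub>\<eta> M"
| trans: "M =\<^sub>\<beta>\<^sub>\<eta> N \<Longrightarrow> N =\<^sub>\<beta>\<^sub>\<eta> P \<Longrightarrow> M =\<^sub>\<beta>\<^sub>\<eta> P"
| cong_Lam: "M =\<^sub>\<beta>\<^sub>\<eta> M' \<Longrightarrow> Lam \<sigma> M =\<^sub>\<beta>\<^sub>\<eta> Lam \<sigma> M'"
| cong_App: "M =\<^sub>\<beta>\<^sub>\<eta> M' \<Longrightarrow> N =\<^sub>\<beta>\<^sub>\<eta> N' \<Longrightarrow> App M N =\<^sub>\<beta>\<^sub>\<eta> App M' N'"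
| cong_TLam: "M =\<^sub>\<beta>\<^sub>\<eta> M' \<Longrightarrow> TLam M =\<^sub>\<beta>\<^sub>\<eta> TLam M'"
| cong_TApp: "M =\<^sub>\<beta>\<^sub>\<eta> M' \<Longrightarrow> TApp M \<sigma> =\<^sub>\<beta>\<^sub>\<eta> TApp M' \<sigma>"


subsection \<open>Retraction\<close>

text \<open>Here \<open>C\<close> is the coder, an open term in \<open>x\<close>, and \<open>D\<close> is the decoder.\<close>

definition retract :: "ty \<Rightarrow> ty \<Rightarrow> bool"  (infix \<open>\<unlhd>\<^sub>F\<close> 50) where
  "\<rho> \<unlhd>\<^sub>F \<tau> \<longleftrightarrow>
    (\<exists>E x C D. finite (dom E) \<and> x \<notin> dom E \<and>
       E(x \<mapsto> \<rho>) \<turnstile> C : \<tau> \<and> E \<turnstile> D : \<tau> \<rightarrow>\<^sub>F \<rho> \<and> x \<notin> FV_tm D \<and>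
       App D C =\<^sub>\<beta>\<^sub>\<eta> Var x)"

end

theory Submission
  imports Defs
begin

text \<open>
  Suppose \<open>a\<close> is free in \<open>\<rho>\<close> but not in \<open>\<tau>\<close>. Rename \<open>a\<close> to a fresh type variable in the coder
  (and in the types it uses), and keep the term variables of coder and decoder apart. Since \<open>a\<close> is not free
  in \<open>\<tau>\<close>, the application of the decoder to the new coder is still typable, with type \<open>\<rho>\<close>, while
  the coder's \<open>x\<close> now has the type \<open>\<rho>\<close> with \<open>a\<close> renamed. Identifying the duplicated variables
  again gives back \<open>DC\<close>, which reduces to \<open>x\<close> by confluence. Reduction lifts along renamings, so
  the new application reduces to a copy of \<open>x\<close>, and subject reduction equates two different types.
\<close>

subsection \<open>Composition of renamings and substitutions\<close>

lemma up_ren_simps [simp]: "up_ren r 0 = 0" "up_ren r (Suc n) = Suc (r n)"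
  by (simp_all add: up_ren_def)

lemma up_ty_simps [simp]: "up_ty \<theta> 0 = TVar 0" "up_ty \<theta> (Suc n) = ren_ty Suc (\<theta> n)"
  by (simp_all add: up_ty_def)

lemma up_tm_simps [simp]: "up_tm s 0 = Var 0" "up_tm s (Suc n) = ren_tm id Suc (s n)"
  by (simp_all add: up_tm_def)

text \<open>Substitutions are functions on indices built by \<open>case_nat\<close>. Two of them are
  compared at the bound index 0 and at the shifted free indices.\<close>

lemma fun_eq_natI: "f 0 = g 0 \<Longrightarrow> (\<And>n. f (Suc n) = g (Suc n)) \<Longrightarrow> f = g"
  by (rule ext) (metis not0_implies_Suc)

lemma up_ren_id [simp]: "up_ren id = id" "up_ren (\<lambda>n. n) = (\<lambda>n. n)"
  by (rule fun_eq_natI; simp)+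

lemma up_ren_comp: "(\<lambda>n. up_ren r (up_ren s n)) = up_ren (\<lambda>n. r (s n))"
  by (rule fun_eq_natI) simp_all

lemma up_ty_TVar [simp]: "up_ty TVar = TVar" "up_ty (\<lambda>n. TVar (r n)) = (\<lambda>n. TVar (up_ren r n))"
  by (rule fun_eq_natI; simp)+

lemma up_tm_Var [simp]: "up_tm Var = Var" "up_tm (\<lambda>n. Var (r n)) = (\<lambda>n. Var (up_ren r n))"
  by (rule fun_eq_natI; simp)+

lemma ren_ty_id [simp]: "ren_ty id \<sigma> = \<sigma>" "ren_ty (\<lambda>n. n) \<sigma> = \<sigma>"
  by (induction \<sigma>) simp_all

lemma subst_ty_TVar [simp]: "subst_ty TVar \<sigma> = \<sigma>"
  by (induction \<sigma>) simp_all

lemma ren_ren_ty: "ren_ty r (ren_ty s \<sigma>) = ren_ty (\<lambda>n. r (s n)) \<sigma>"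
  by (induction \<sigma> arbitrary: r s) (simp_all add: up_ren_comp)

lemma subst_ren_ty: "subst_ty \<theta> (ren_ty r \<sigma>) = subst_ty (\<lambda>n. \<theta> (r n)) \<sigma>"
proof (induction \<sigma> arbitrary: \<theta> r)
  case (All \<sigma>)
  have "(\<lambda>n. up_ty \<theta> (up_ren r n)) = up_ty (\<lambda>n. \<theta> (r n))"
    by (rule fun_eq_natI) simp_all
  then show ?case by (simp add: All)
qed simp_all

lemma ren_subst_ty: "ren_ty r (subst_ty \<theta> \<sigma>) = subst_ty (\<lambda>n. ren_ty r (\<theta> n)) \<sigma>"
proof (induction \<sigma> arbitrary: \<theta> r)
  case (All \<sigma>)
  have "(\<lambda>n. ren_ty (up_ren r) (up_ty \<theta> n)) = up_ty (\<lambda>n. ren_ty r (\<theta> n))"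
    by (rule fun_eq_natI) (simp_all add: ren_ren_ty)
  then show ?case by (simp add: All)
qed simp_all

text \<open>Since \<open>up_ty\<close> itself renames, the binder case needs both mixed composition
  laws, renaming before and after substitution.\<close>

lemma subst_subst_ty: "subst_ty \<theta> (subst_ty \<theta>' \<sigma>) = subst_ty (\<lambda>n. subst_ty \<theta> (\<theta>' n)) \<sigma>"
proof (induction \<sigma> arbitrary: \<theta> \<theta>')
  case (All \<sigma>)
  have "(\<lambda>n. subst_ty (up_ty \<theta>) (up_ty \<theta>' n)) = up_ty (\<lambda>n. subst_ty \<theta> (\<theta>' n))"
    by (rule fun_eq_natI) (simp_all add: subst_ren_ty ren_subst_ty)
  then show ?case by (simp add: All)
qed simp_all

lemma ren_ty_eq_subst: "ren_ty r \<sigma> = subst_ty (\<lambda>n. TVar (r n)) \<sigma>"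
  by (induction \<sigma> arbitrary: r) simp_all

lemma ren_tm_id [simp]: "ren_tm id id M = M" "ren_tm (\<lambda>n. n) (\<lambda>n. n) M = M"
  by (induction M) simp_all

lemma subst_tm_Var [simp]: "subst_tm TVar Var M = M"
  by (induction M) (simp_all)

lemma ren_ren_tm: "ren_tm q r (ren_tm q' r' M) = ren_tm (\<lambda>n. q (q' n)) (\<lambda>n. r (r' n)) M"
  by (induction M arbitrary: q r q' r') (simp_all add: ren_ren_ty up_ren_comp)

lemma ren_tm_eq_subst: "ren_tm q r M = subst_tm (\<lambda>n. TVar (q n)) (\<lambda>n. Var (r n)) M"
  by (induction M arbitrary: q r) (simp_all add: ren_ty_eq_subst)

lemma subst_ren_tm:
  "subst_tm \<theta> s (ren_tm q r M) = subst_tm (\<lambda>n. \<theta> (q n)) (\<lambda>n. s (r n)) M"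
proof (induction M arbitrary: \<theta> s q r)
  case (Lam \<sigma> M)
  have "(\<lambda>n. up_tm s (up_ren r n)) = up_tm (\<lambda>n. s (r n))"
    by (rule fun_eq_natI) simp_all
  then show ?case by (simp add: Lam subst_ren_ty)
next
  case (TLam M)
  have "(\<lambda>n. up_ty \<theta> (up_ren q n)) = up_ty (\<lambda>n. \<theta> (q n))"
    by (rule fun_eq_natI) simp_all
  then show ?case by (simp add: TLam)
qed (simp_all add: subst_ren_ty)

lemma ren_subst_tm:
  "ren_tm q r (subst_tm \<theta> s M) = subst_tm (\<lambda>n. ren_ty q (\<theta> n)) (\<lambda>n. ren_tm q r (s n)) M"
proof (induction M arbitrary: \<theta> s q r)
  case (Lam \<sigma> M)
  have "(\<lambda>n. ren_tm q (up_ren r) (up_tm s n)) = up_tm (\<lambda>n. ren_tm q r (s n))"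
    by (rule fun_eq_natI) (simp_all add: ren_ren_tm)
  then show ?case by (simp add: Lam ren_subst_ty)
next
  case (TLam M)
  have "(\<lambda>n. ren_ty (up_ren q) (up_ty \<theta> n)) = up_ty (\<lambda>n. ren_ty q (\<theta> n))"
    by (rule fun_eq_natI) (simp_all add: ren_ren_ty)
  then show ?case by (simp add: TLam ren_ren_tm)
qed (simp_all add: ren_subst_ty)

lemma subst_subst_tm:
  "subst_tm \<theta> s (subst_tm \<theta>' s' M) = subst_tm (\<lambda>n. subst_ty \<theta> (\<theta>' n)) (\<lambda>n. subst_tm \<theta> s (s' n)) M"
proof (induction M arbitrary: \<theta> s \<theta>' s')
  case (Lam \<sigma> M)
  have "(\<lambda>n. subst_tm \<theta> (up_tm s) (up_tm s' n)) = up_tm (\<lambda>n. subst_tm \<theta> s (s' n))"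
    by (rule fun_eq_natI) (simp_all add: ren_subst_tm subst_ren_tm)
  then show ?case by (simp add: Lam subst_subst_ty)
next
  case (TLam M)
  have "(\<lambda>n. subst_ty (up_ty \<theta>) (up_ty \<theta>' n)) = up_ty (\<lambda>n. subst_ty \<theta> (\<theta>' n))"
    by (rule fun_eq_natI) (simp_all add: subst_ren_ty ren_subst_ty)
  then show ?case by (simp add: TLam ren_subst_tm subst_ren_tm)
qed (simp_all add: subst_subst_ty)

section \<open>Instantiation and shifts commute with substitution and renaming\<close>

lemma subst_inst_ty: "subst_ty \<theta> (inst_ty \<tau> \<sigma>) = inst_ty (subst_ty (up_ty \<theta>) \<tau>) (subst_ty \<theta> \<sigma>)"
proof -
  have "(\<lambda>n. subst_ty \<theta> (case_nat \<sigma> TVar n))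
      = (\<lambda>n. subst_ty (case_nat (subst_ty \<theta> \<sigma>) TVar) (up_ty \<theta> n))"
    by (rule fun_eq_natI) (simp_all add: subst_ren_ty)
  then show ?thesis by (simp add: inst_ty_def subst_subst_ty)
qed

lemma subst_inst_tm:
  "subst_tm \<theta> s (inst_tm M N) = inst_tm (subst_tm \<theta> (up_tm s) M) (subst_tm \<theta> s N)"
proof -
  have "(\<lambda>n. subst_tm \<theta> s (case_nat N Var n))
      = (\<lambda>n. subst_tm TVar (case_nat (subst_tm \<theta> s N) Var) (up_tm s n))"
    by (rule fun_eq_natI) (simp_all add: subst_ren_tm)
  then show ?thesis by (simp add: inst_tm_def subst_subst_tm)
qed

lemma subst_inst_tm_ty:
  "subst_tm \<theta> s (inst_tm_ty M \<sigma>)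
    = inst_tm_ty (subst_tm (up_ty \<theta>) (\<lambda>n. ren_tm Suc id (s n)) M) (subst_ty \<theta> \<sigma>)"
proof -
  have "(\<lambda>n. subst_ty \<theta> (case_nat \<sigma> TVar n))
      = (\<lambda>n. subst_ty (case_nat (subst_ty \<theta> \<sigma>) TVar) (up_ty \<theta> n))"
    by (rule fun_eq_natI) (simp_all add: subst_ren_ty)
  then show ?thesis by (simp add: inst_tm_ty_def subst_subst_tm subst_ren_tm)
qed

lemma ren_inst_ty: "ren_ty q (inst_ty \<tau> \<sigma>) = inst_ty (ren_ty (up_ren q) \<tau>) (ren_ty q \<sigma>)"
  by (simp add: ren_ty_eq_subst subst_inst_ty)

lemma ren_inst_tm: "ren_tm q r (inst_tm M N) = inst_tm (ren_tm q (up_ren r) M) (ren_tm q r N)"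
  by (simp add: ren_tm_eq_subst subst_inst_tm)

lemma ren_inst_tm_ty:
  "ren_tm q r (inst_tm_ty M \<sigma>) = inst_tm_ty (ren_tm (up_ren q) r M) (ren_ty q \<sigma>)"
  by (simp add: ren_tm_eq_subst ren_ty_eq_subst subst_inst_tm_ty)

text \<open>These equations make renamings send eta-redexes to eta-redexes of both kinds.\<close>

lemma ren_tm_shift:
  "ren_tm q (up_ren r) (ren_tm id Suc M) = ren_tm id Suc (ren_tm q r M)"
  "ren_tm (up_ren q) r (ren_tm Suc id M) = ren_tm Suc id (ren_tm q r M)"
  by (simp_all add: ren_ren_tm)

lemma subst_tm_shift:
  "subst_tm \<theta> (up_tm s) (ren_tm id Suc M) = ren_tm id Suc (subst_tm \<theta> s M)"
  "subst_tm (up_ty \<theta>) (\<lambda>n. ren_tm Suc id (s n)) (ren_tm Suc id M) = ren_tm Suc id (subst_tm \<theta> s M)"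
  by (simp_all add: subst_ren_tm ren_subst_tm)

lemma inst_shift [simp]:
  "inst_tm (ren_tm id Suc M) N = M"
  "inst_tm_ty (ren_tm Suc id M) \<sigma> = M"
  by (simp_all add: inst_tm_def inst_tm_ty_def subst_ren_tm)

text \<open>Shifting below a binder and then filling the binder with the new variable 0 is the
  identity on indices. So contracting a shifted abstraction applied to variable 0 gives back the
  body.\<close>

lemma inst_up_shift [simp]:
  "inst_tm (ren_tm id (up_ren Suc) M) (Var 0) = M"
  "inst_tm_ty (ren_tm (up_ren Suc) id M) (TVar 0) = M"
  "inst_ty (ren_ty (up_ren Suc) \<tau>) (TVar 0) = \<tau>"
proof -
  have "(\<lambda>n. case_nat (Var 0) Var (up_ren Suc n)) = Var"
    and *: "(\<lambda>n. case_nat (TVar 0) TVar (up_ren Suc n)) = TVar"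
    by (rule fun_eq_natI; simp)+
  then show "inst_tm (ren_tm id (up_ren Suc) M) (Var 0) = M"
    "inst_tm_ty (ren_tm (up_ren Suc) id M) (TVar 0) = M"
    by (simp_all add: inst_tm_def inst_tm_ty_def subst_ren_tm)
  show "inst_ty (ren_ty (up_ren Suc) \<tau>) (TVar 0) = \<tau>"
    by (simp add: inst_ty_def subst_ren_ty *)
qed

lemma inst_simps [simp]:
  "inst_tm (App M N) P = App (inst_tm M P) (inst_tm N P)"
  "inst_tm (Var 0) P = P"
  "inst_tm_ty (TApp M \<sigma>) \<rho> = TApp (inst_tm_ty M \<rho>) (inst_ty \<sigma> \<rho>)"
  "inst_ty (TVar 0) \<rho> = \<rho>"
  by (simp_all add: inst_tm_def inst_tm_ty_def inst_ty_def)

text \<open>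
  The nontrivial half of being a weak pullback. Syntax preserves it (\<open>pullback_tm\<close>), which allows
  cancelling a shift against an arbitrary renaming, injective or not.
\<close>

definition pullback :: "(nat \<Rightarrow> nat) \<Rightarrow> (nat \<Rightarrow> nat) \<Rightarrow> (nat \<Rightarrow> nat) \<Rightarrow> (nat \<Rightarrow> nat) \<Rightarrow> bool" where
  "pullback q1 q2 p1 p2 \<longleftrightarrow> (\<forall>i j. q1 i = q2 j \<longrightarrow> (\<exists>k. i = p1 k \<and> j = p2 k))"

lemma pullback_up:
  assumes "pullback q1 q2 p1 p2"
  shows "pullback (up_ren q1) (up_ren q2) (up_ren p1) (up_ren p2)"
  unfolding pullback_def
proof (intro allI impI)
  fix i j
  assume eq: "up_ren q1 i = up_ren q2 j"
  show "\<exists>k. i = up_ren p1 k \<and> j = up_ren p2 k"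
  proof (cases i)
    case 0
    with eq show ?thesis by (cases j) (auto intro: exI[of _ 0])
  next
    case (Suc i')
    with eq obtain j' where "j = Suc j'" "q1 i' = q2 j'" by (cases j) auto
    with Suc assms obtain k where "i = Suc (p1 k)" "j = Suc (p2 k)"
      by (auto simp: pullback_def)
    then show ?thesis by (intro exI[of _ "Suc k"]) simp
  qed
qed

lemma pullback_id: "pullback q id id q"
  by (auto simp: pullback_def)

text \<open>\<open>up_ren q\<close> reaches a successor only from a successor. In this form the
  lemma expresses that a renaming reflects the absence of the bound variable.\<close>

lemma pullback_shift: "pullback (up_ren q) Suc Suc q"
  unfolding pullback_def
proof (intro allI impI)
  fix i j
  assume "up_ren q i = Suc j"
  then show "\<exists>k. i = Suc k \<and> j = q k" by (cases i) auto
qed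

lemma pullback_ty:
  assumes "ren_ty q1 \<sigma> = ren_ty q2 \<tau>" "pullback q1 q2 p1 p2"
  shows "\<exists>\<upsilon>. \<sigma> = ren_ty p1 \<upsilon> \<and> \<tau> = ren_ty p2 \<upsilon>"
  using assms
proof (induction \<sigma> arbitrary: \<tau> q1 q2 p1 p2)
  case (TVar n)
  then obtain m where m: "\<tau> = TVar m" "q1 n = q2 m" by (cases \<tau>) auto
  with TVar obtain k where "n = p1 k" "m = p2 k" by (auto simp: pullback_def)
  with m show ?case by (intro exI[of _ "TVar k"]) simp
next
  case (Arr \<sigma>1 \<sigma>2)
  then obtain \<tau>1 \<tau>2 where t: "\<tau> = \<tau>1 \<rightarrow>\<^sub>F \<tau>2"
    "ren_ty q1 \<sigma>1 = ren_ty q2 \<tau>1" "ren_ty q1 \<sigma>2 = ren_ty q2 \<tau>2" by (cases \<tau>) auto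
  from Arr.IH(1)[OF t(2) Arr.prems(2)] Arr.IH(2)[OF t(3) Arr.prems(2)]
  obtain \<upsilon>1 \<upsilon>2 where "\<sigma>1 = ren_ty p1 \<upsilon>1" "\<tau>1 = ren_ty p2 \<upsilon>1"
    "\<sigma>2 = ren_ty p1 \<upsilon>2" "\<tau>2 = ren_ty p2 \<upsilon>2" by blast
  with t show ?case by (intro exI[of _ "\<upsilon>1 \<rightarrow>\<^sub>F \<upsilon>2"]) simp
next
  case (All \<sigma>')
  then obtain \<tau>' where t: "\<tau> = All \<tau>'" "ren_ty (up_ren q1) \<sigma>' = ren_ty (up_ren q2) \<tau>'"
    by (cases \<tau>) auto
  from All.IH[OF t(2) pullback_up[OF All.prems(2)]]
  obtain \<upsilon> where "\<sigma>' = ren_ty (up_ren p1) \<upsilon>" "\<tau>' = ren_ty (up_ren p2) \<upsilon>" by blast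
  with t show ?case by (intro exI[of _ "All \<upsilon>"]) simp
qed

lemma pullback_tm:
  assumes "ren_tm q1 r1 M = ren_tm q2 r2 N" "pullback q1 q2 p1 p2" "pullback r1 r2 s1 s2"
  shows "\<exists>P. M = ren_tm p1 s1 P \<and> N = ren_tm p2 s2 P"
  using assms
proof (induction M arbitrary: N q1 q2 p1 p2 r1 r2 s1 s2)
  case (Var n)
  then obtain m where m: "N = Var m" "r1 n = r2 m" by (cases N) auto
  with Var.prems(3) obtain k where "n = s1 k" "m = s2 k" by (auto simp: pullback_def)
  with m show ?case by (intro exI[of _ "Var k"]) simp
next
  case (Lam \<sigma> M)
  then obtain \<tau> N' where t: "N = Lam \<tau> N'" "ren_ty q1 \<sigma> = ren_ty q2 \<tau>"
    "ren_tm q1 (up_ren r1) M = ren_tm q2 (up_ren r2) N'" by (cases N) auto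
  from Lam.IH[OF t(3) Lam.prems(2) pullback_up[OF Lam.prems(3)]] pullback_ty[OF t(2) Lam.prems(2)]
  obtain P \<upsilon> where "M = ren_tm p1 (up_ren s1) P" "N' = ren_tm p2 (up_ren s2) P"
    "\<sigma> = ren_ty p1 \<upsilon>" "\<tau> = ren_ty p2 \<upsilon>" by blast
  with t show ?case by (intro exI[of _ "Lam \<upsilon> P"]) simp
next
  case (App M1 M2)
  then obtain N1 N2 where t: "N = App N1 N2"
    "ren_tm q1 r1 M1 = ren_tm q2 r2 N1" "ren_tm q1 r1 M2 = ren_tm q2 r2 N2" by (cases N) auto
  from App.IH(1)[OF t(2) App.prems(2,3)] App.IH(2)[OF t(3) App.prems(2,3)]
  obtain P1 P2 where "M1 = ren_tm p1 s1 P1" "N1 = ren_tm p2 s2 P1"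
    "M2 = ren_tm p1 s1 P2" "N2 = ren_tm p2 s2 P2" by blast
  with t show ?case by (intro exI[of _ "App P1 P2"]) simp
next
  case (TLam M)
  then obtain N' where t: "N = TLam N'"
    "ren_tm (up_ren q1) r1 M = ren_tm (up_ren q2) r2 N'" by (cases N) auto
  from TLam.IH[OF t(2) pullback_up[OF TLam.prems(2)] TLam.prems(3)]
  obtain P where "M = ren_tm (up_ren p1) s1 P" "N' = ren_tm (up_ren p2) s2 P" by blast
  with t show ?case by (intro exI[of _ "TLam P"]) simp
next
  case (TApp M \<sigma>)
  then obtain \<tau> N' where t: "N = TApp N' \<tau>" "ren_ty q1 \<sigma> = ren_ty q2 \<tau>"
    "ren_tm q1 r1 M = ren_tm q2 r2 N'" by (cases N) auto
  from TApp.IH[OF t(3) TApp.prems(2,3)] pullback_ty[OF t(2) TApp.prems(2)]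
  obtain P \<upsilon> where "M = ren_tm p1 s1 P" "N' = ren_tm p2 s2 P"
    "\<sigma> = ren_ty p1 \<upsilon>" "\<tau> = ren_ty p2 \<upsilon>" by blast
  with t show ?case by (intro exI[of _ "TApp P \<upsilon>"]) simp
qed

text \<open>For injective renamings the two identities complete the square, so both terms are the
  same term \<open>P\<close>.\<close>

lemma ren_tm_inj:
  assumes "ren_tm q r M = ren_tm q r N" "inj q" "inj r"
  shows "M = N"
proof -
  have "pullback q q id id" "pullback r r id id"
    using assms(2,3) by (auto simp: pullback_def dest: injD)
  from pullback_tm[OF assms(1) this] show ?thesis by (metis ren_tm_id(1))
qed


subsection \<open>Parallel reduction\<close>

text \<open>
  Raw beta-eta equality identifies all annotations of a \<open>Lam\<close>: the term \<open>Lam \<sigma> (App (Lam \<tau> M) (Var 0))\<close>,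
  with \<open>M\<close> shifted, is equal to both \<open>Lam \<sigma> M\<close> and \<open>Lam \<tau> M\<close>. Confluence therefore needs
  annotations to be erased; \<open>any\<close> is a closed type, so that erasure commutes with substitution.
\<close>

definition any :: ty where "any = All (TVar 0)"

primrec erase :: "tm \<Rightarrow> tm" where
  "erase (Var n) = Var n"
| "erase (Lam \<sigma> M) = Lam any (erase M)"
| "erase (App M N) = App (erase M) (erase N)"
| "erase (TLam M) = TLam (erase M)"
| "erase (TApp M \<sigma>) = TApp (erase M) \<sigma>"

lemma any_invariant [simp]: "ren_ty q any = any" "subst_ty \<theta> any = any"
  by (simp_all add: any_def)

lemma ren_ty_eq_TVar_0: "ren_ty (up_ren q) \<sigma> = TVar 0 \<longleftrightarrow> \<sigma> = TVar 0"
  by (cases \<sigma>) (auto simp: up_ren_def split: nat.split)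

text \<open>Lets a redex annotated with \<open>any\<close> be recognised before a renaming is
  applied to it.\<close>

lemma ren_ty_eq_any: "ren_ty q \<sigma> = any \<longleftrightarrow> \<sigma> = any"
  by (cases \<sigma>) (auto simp: any_def ren_ty_eq_TVar_0)

lemma erase_ren: "erase (ren_tm q r M) = ren_tm q r (erase M)"
  by (induction M arbitrary: q r) simp_all

lemma erase_subst: "erase (subst_tm \<theta> s M) = subst_tm \<theta> (\<lambda>n. erase (s n)) (erase M)"
proof (induction M arbitrary: \<theta> s)
  case (Lam \<sigma> M)
  have "(\<lambda>n. erase (up_tm s n)) = up_tm (\<lambda>n. erase (s n))"
    by (rule fun_eq_natI) (simp_all add: erase_ren)
  then show ?case by (simp add: Lam)
qed (simp_all add: erase_ren)

lemma erase_inst: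
  "erase (inst_tm M N) = inst_tm (erase M) (erase N)"
  "erase (inst_tm_ty M \<sigma>) = inst_tm_ty (erase M) \<sigma>"
proof -
  have "(\<lambda>n. erase (case_nat N Var n)) = case_nat (erase N) Var"
    by (rule fun_eq_natI) simp_all
  then show "erase (inst_tm M N) = inst_tm (erase M) (erase N)"
    "erase (inst_tm_ty M \<sigma>) = inst_tm_ty (erase M) \<sigma>"
    by (simp_all add: inst_tm_def inst_tm_ty_def erase_subst)
qed

text \<open>Parallel reduction in the style of Tait and Martin-Loef, with both eta rules. The
  abstraction rules demand the annotation \<open>any\<close>, so reflexivity holds only for erased
  terms.\<close>

inductive par :: "tm \<Rightarrow> tm \<Rightarrow> bool"  (infix \<open>\<Rrightarrow>\<close> 50) where
  par_Var: "Var n \<Rrightarrow> Var n"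
| par_Lam: "M \<Rrightarrow> M' \<Longrightarrow> Lam any M \<Rrightarrow> Lam any M'"
| par_App: "M \<Rrightarrow> M' \<Longrightarrow> N \<Rrightarrow> N' \<Longrightarrow> App M N \<Rrightarrow> App M' N'"
| par_TLam: "M \<Rrightarrow> M' \<Longrightarrow> TLam M \<Rrightarrow> TLam M'"
| par_TApp: "M \<Rrightarrow> M' \<Longrightarrow> TApp M \<sigma> \<Rrightarrow> TApp M' \<sigma>"
| par_beta: "M \<Rrightarrow> M' \<Longrightarrow> N \<Rrightarrow> N' \<Longrightarrow> App (Lam any M) N \<Rrightarrow> inst_tm M' N'"
| par_tbeta: "M \<Rrightarrow> M' \<Longrightarrow> TApp (TLam M) \<sigma> \<Rrightarrow> inst_tm_ty M' \<sigma>"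
| par_eta: "M \<Rrightarrow> M' \<Longrightarrow> Lam any (App (ren_tm id Suc M) (Var 0)) \<Rrightarrow> M'"
| par_teta: "M \<Rrightarrow> M' \<Longrightarrow> TLam (TApp (ren_tm Suc id M) (TVar 0)) \<Rrightarrow> M'"

inductive_cases par_VarE: "Var n \<Rrightarrow> P"
inductive_cases par_LamE [consumes 1, case_names 1 2]: "Lam \<sigma> M \<Rrightarrow> P"
inductive_cases par_AppE [consumes 1, case_names 1 2]: "App M N \<Rrightarrow> P"
inductive_cases par_TLamE [consumes 1, case_names 1 2]: "TLam M \<Rrightarrow> P"
inductive_cases par_TAppE [consumes 1, case_names 1 2]: "TApp M \<sigma> \<Rrightarrow> P"

lemma par_erase: "erase M \<Rrightarrow> erase M"
  by (induction M) (auto intro: par.intros)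

lemma par_ren: "M \<Rrightarrow> M' \<Longrightarrow> ren_tm q r M \<Rrightarrow> ren_tm q r M'"
  by (induction arbitrary: q r rule: par.induct)
    (auto simp: ren_inst_tm ren_inst_tm_ty ren_tm_shift intro: par.intros)

text \<open>The substitutions reduce too, because a parallel beta step reduces body and argument at
  once.\<close>

lemma par_subst:
  assumes "M \<Rrightarrow> M'" "\<And>n. s n \<Rrightarrow> s' n"
  shows "subst_tm \<theta> s M \<Rrightarrow> subst_tm \<theta> s' M'"
  using assms
proof (induction arbitrary: \<theta> s s' rule: par.induct)
  case (par_Lam M M')
  have "up_tm s n \<Rrightarrow> up_tm s' n" for n
    by (cases n) (auto intro: par.par_Var par_ren par_Lam.prems)
  then show ?case by (auto intro: par.par_Lam par_Lam.IH)
next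
  case (par_beta M M' N N')
  have "up_tm s n \<Rrightarrow> up_tm s' n" for n
    by (cases n) (auto intro: par.par_Var par_ren par_beta.prems)
  then show ?case by (auto simp: subst_inst_tm intro!: par.par_beta par_beta.IH par_beta.prems)
next
  case (par_tbeta M M' \<sigma>)
  then show ?case by (simp add: subst_inst_tm_ty par.par_tbeta par_ren)
next
  case (par_eta M M')
  then show ?case by (simp add: subst_tm_shift par.par_eta)
next
  case (par_teta M M')
  then show ?case by (simp add: subst_tm_shift par.par_teta)
qed (simp_all add: par.intros par_ren)

lemma par_inst:
  assumes "M \<Rrightarrow> M'"
  shows "N \<Rrightarrow> N' \<Longrightarrow> inst_tm M N \<Rrightarrow> inst_tm M' N'" "inst_tm_ty M \<sigma> \<Rrightarrow> inst_tm_ty M' \<sigma>"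
  unfolding inst_tm_def inst_tm_ty_def
  by (rule par_subst[OF assms]; auto intro: par.par_Var split: nat.split)+

text \<open>Renaming creates no redex, even when it identifies variables: a beta-redex is visible
  from the constructors, and the side condition of an eta-redex is reflected by the pullback
  property.\<close>

lemma par_lift:
  assumes "ren_tm q r M \<Rrightarrow> P"
  shows "\<exists>M'. M \<Rrightarrow> M' \<and> P = ren_tm q r M'"
  using assms
proof (induction "ren_tm q r M" P arbitrary: q r M rule: par.induct)
  case (par_Var n)
  from par_Var[symmetric] obtain m where "M = Var m" by (cases M) auto
  with par_Var show ?case by (auto intro!: exI[of _ "Var m"] par.par_Var)
next
  case (par_Lam A A')
  from par_Lam(3)[symmetric] obtain B where B: "M = Lam any B" "A = ren_tm q (up_ren r) B"
    by (cases M) (auto simp: ren_ty_eq_any)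
  from par_Lam(2)[OF B(2)] obtain B' where "B \<Rrightarrow> B'" "A' = ren_tm q (up_ren r) B'" by blast
  with B show ?case by (intro exI[of _ "Lam any B'"]) (simp add: par.par_Lam)
next
  case (par_App A A' B B')
  from par_App(5)[symmetric] obtain A0 B0
    where M: "M = App A0 B0" "A = ren_tm q r A0" "B = ren_tm q r B0" by (cases M) auto
  from par_App(2)[OF M(2)] par_App(4)[OF M(3)] obtain A1 B1
    where "A0 \<Rrightarrow> A1" "A' = ren_tm q r A1" "B0 \<Rrightarrow> B1" "B' = ren_tm q r B1" by blast
  with M show ?case by (intro exI[of _ "App A1 B1"]) (simp add: par.par_App)
next
  case (par_TLam A A')
  from par_TLam(3)[symmetric] obtain B where B: "M = TLam B" "A = ren_tm (up_ren q) r B"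
    by (cases M) auto
  from par_TLam(2)[OF B(2)] obtain B' where "B \<Rrightarrow> B'" "A' = ren_tm (up_ren q) r B'" by blast
  with B show ?case by (intro exI[of _ "TLam B'"]) (simp add: par.par_TLam)
next
  case (par_TApp A A' \<sigma>)
  from par_TApp(3)[symmetric] obtain B \<tau>
    where B: "M = TApp B \<tau>" "\<sigma> = ren_ty q \<tau>" "A = ren_tm q r B" by (cases M) auto
  from par_TApp(2)[OF B(3)] obtain B' where "B \<Rrightarrow> B'" "A' = ren_tm q r B'" by blast
  with B show ?case by (intro exI[of _ "TApp B' \<tau>"]) (simp add: par.par_TApp)
next
  case (par_beta A A' B B')
  from par_beta(5)[symmetric] obtain F B0
    where M: "M = App F B0" "ren_tm q r F = Lam any A" "B = ren_tm q r B0" by (cases M) auto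
  then obtain A0 where F: "F = Lam any A0" "A = ren_tm q (up_ren r) A0"
    by (cases F) (auto simp: ren_ty_eq_any)
  from par_beta(2)[OF F(2)] par_beta(4)[OF M(3)] obtain A1 B1
    where "A0 \<Rrightarrow> A1" "A' = ren_tm q (up_ren r) A1" "B0 \<Rrightarrow> B1" "B' = ren_tm q r B1" by blast
  with M F show ?case by (intro exI[of _ "inst_tm A1 B1"]) (simp add: par.par_beta ren_inst_tm)
next
  case (par_tbeta A A' \<sigma>)
  from par_tbeta(3)[symmetric] obtain F \<tau>
    where M: "M = TApp F \<tau>" "ren_tm q r F = TLam A" "\<sigma> = ren_ty q \<tau>" by (cases M) auto
  then obtain A0 where F: "F = TLam A0" "A = ren_tm (up_ren q) r A0" by (cases F) auto
  from par_tbeta(2)[OF F(2)] obtain A1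
    where "A0 \<Rrightarrow> A1" "A' = ren_tm (up_ren q) r A1" by blast
  with M F show ?case
    by (intro exI[of _ "inst_tm_ty A1 \<tau>"]) (simp add: par.par_tbeta ren_inst_tm_ty)
next
  case (par_eta A A')
  from par_eta(3)[symmetric] obtain B
    where M: "M = Lam any B" "ren_tm q (up_ren r) B = App (ren_tm id Suc A) (Var 0)"
    by (cases M) (auto simp: ren_ty_eq_any)
  then obtain F X where B: "B = App F X" "ren_tm q (up_ren r) F = ren_tm id Suc A"
    "ren_tm q (up_ren r) X = Var 0" by (cases B) auto
  then have X: "X = Var 0" by (cases X) (auto simp: up_ren_def split: nat.splits)
  \<comment> \<open>The bound variable is absent from the renamed function part. The square of
    \<open>up_ren r\<close> and \<open>Suc\<close> shows that it is absent from \<open>F\<close> as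
    well, so \<open>M\<close> is already an eta-redex.\<close>
  from pullback_tm[OF B(2) pullback_id pullback_shift] obtain A0
    where A0: "F = ren_tm id Suc A0" "A = ren_tm q r A0" by blast
  from par_eta(2)[OF A0(2)] obtain A1 where "A0 \<Rrightarrow> A1" "A' = ren_tm q r A1" by blast
  with M B X A0 show ?case by (intro exI[of _ A1]) (simp add: par.par_eta)
next
  case (par_teta A A')
  from par_teta(3)[symmetric] obtain B
    where M: "M = TLam B" "ren_tm (up_ren q) r B = TApp (ren_tm Suc id A) (TVar 0)"
    by (cases M) auto
  then obtain F \<tau> where B: "B = TApp F \<tau>" "ren_tm (up_ren q) r F = ren_tm Suc id A" "\<tau> = TVar 0"
    by (cases B) (auto simp: ren_ty_eq_TVar_0)
  from pullback_tm[OF B(2) pullback_shift pullback_id] obtain A0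
    where A0: "F = ren_tm Suc id A0" "A = ren_tm q r A0" by blast
  from par_teta(2)[OF A0(2)] obtain A1 where "A0 \<Rrightarrow> A1" "A' = ren_tm q r A1" by blast
  with M B A0 show ?case by (intro exI[of _ A1]) (simp add: par.par_teta)
qed

section \<open>The diamond property\<close>

lemma size_ren_tm [simp]: "size (ren_tm q r M) = size M"
  by (induction M arbitrary: q r) simp_all

abbreviation joins :: "tm \<Rightarrow> tm \<Rightarrow> bool" where
  "joins M N \<equiv> \<exists>P. M \<Rrightarrow> P \<and> N \<Rrightarrow> P"

text \<open>Controls the overlap of eta with a reduction below the abstraction. If the application
  is contracted by beta, \<open>K\<close> is an abstraction and beta merely undoes the expansion, so
  \<open>K\<close> itself reduces to \<open>Lam any A\<close>.\<close>

lemma par_eta_cong: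
  assumes "App (ren_tm id Suc K) (Var 0) \<Rrightarrow> A"
  shows "\<exists>K'. K \<Rrightarrow> K' \<and> (A = App (ren_tm id Suc K') (Var 0) \<or> K' = Lam any A)"
  using assms
proof (cases rule: par_AppE)
  case (1 F X)
  then show ?thesis using par_lift[of id Suc K F] by (auto elim: par_VarE)
next
  case (2 B B' X)
  then obtain B0 where B: "K = Lam any B0" "B = ren_tm id (up_ren Suc) B0"
    by (cases K) auto
  with 2 par_lift[of id "up_ren Suc" B0 B'] obtain B1
    where "B0 \<Rrightarrow> B1" "B' = ren_tm id (up_ren Suc) B1" by auto
  with 2 B have "K \<Rrightarrow> Lam any A" by (auto intro: par.par_Lam elim!: par_VarE)
  then show ?thesis by blast
qed

text \<open>The counterpart of \<open>par_eta_cong\<close> for type abstraction.\<close>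

lemma par_teta_cong:
  assumes "TApp (ren_tm Suc id K) (TVar 0) \<Rrightarrow> A"
  shows "\<exists>K'. K \<Rrightarrow> K' \<and> (A = TApp (ren_tm Suc id K') (TVar 0) \<or> K' = TLam A)"
  using assms
proof (cases rule: par_TAppE)
  case (1 F)
  then show ?thesis using par_lift[of Suc id K F] by auto
next
  case (2 B B')
  then obtain B0 where B: "K = TLam B0" "B = ren_tm (up_ren Suc) id B0"
    by (cases K) auto
  with 2 par_lift[of "up_ren Suc" id B0 B'] obtain B1
    where "B0 \<Rrightarrow> B1" "B' = ren_tm (up_ren Suc) id B1" by auto
  with 2 B have "K \<Rrightarrow> TLam A" by (auto intro: par.par_TLam)
  then show ?thesis by blast
qed

text \<open>The induction is on size, not on derivations: where beta overlaps with eta, the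
  hypothesis is applied to a term that is smaller than \<open>M\<close> but no subterm of
  it.\<close>

lemma par_diamond: "M \<Rrightarrow> M1 \<Longrightarrow> M \<Rrightarrow> M2 \<Longrightarrow> joins M1 M2"
proof (induction "size M" arbitrary: M M1 M2 rule: less_induct)
  case less
  note IH = less.hyps
  show ?case
  proof (cases M)
    case (Var n)
    with less.prems show ?thesis by (auto elim!: par_VarE intro: par_Var)
  next
    case (Lam \<sigma> A)
    \<comment> \<open>Congruence against eta. Either \<open>Lam any A1\<close> is still an eta-redex
      with contractum \<open>K'\<close>, or it equals \<open>K'\<close>; joining \<open>K'\<close>
      with \<open>K2\<close> suffices in both cases.\<close>
    have eta: "joins (Lam any A1) K2"
      if "A \<Rrightarrow> A1" "A = App (ren_tm id Suc K) (Var 0)" "K \<Rrightarrow> K2" for A1 K K2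
    proof -
      from par_eta_cong that obtain K'
        where K': "K \<Rrightarrow> K'" "A1 = App (ren_tm id Suc K') (Var 0) \<or> K' = Lam any A1" by blast
      from IH[OF _ K'(1) that(3)] Lam that obtain P where "K' \<Rrightarrow> P" "K2 \<Rrightarrow> P" by auto
      with K'(2) show ?thesis by (auto intro: par_eta)
    qed
    from less.prems(1)[unfolded Lam] show ?thesis
    proof (cases rule: par_LamE)
      case M1: (1 A1)
      from less.prems(2)[unfolded Lam] show ?thesis
      proof (cases rule: par_LamE)
        case (1 A2)
        with IH[of A A1 A2] M1 Lam show ?thesis by (auto intro: par_Lam)
      next
        case (2 K)
        with eta M1 show ?thesis by blast
      qed
    next
      case M1: (2 K)
      from less.prems(2)[unfolded Lam] show ?thesis
      proof (cases rule: par_LamE)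
        case (1 A2)
        with eta M1 show ?thesis by blast
      next
        case (2 K2)
        \<comment> \<open>Shifts are injective, so the body determines the eta-contractum.\<close>
        with M1 have "K2 = K" by (auto dest: ren_tm_inj)
        with IH[of K M1 M2] 2 M1 Lam show ?thesis by auto
      qed
    qed
  next
    case (TLam A)
    have eta: "joins (TLam A1) K2"
      if "A \<Rrightarrow> A1" "A = TApp (ren_tm Suc id K) (TVar 0)" "K \<Rrightarrow> K2" for A1 K K2
    proof -
      from par_teta_cong that obtain K'
        where K': "K \<Rrightarrow> K'" "A1 = TApp (ren_tm Suc id K') (TVar 0) \<or> K' = TLam A1" by blast
      from IH[OF _ K'(1) that(3)] TLam that obtain P where "K' \<Rrightarrow> P" "K2 \<Rrightarrow> P" by auto
      with K'(2) show ?thesis by (auto intro: par_teta)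
    qed
    from less.prems(1)[unfolded TLam] show ?thesis
    proof (cases rule: par_TLamE)
      case M1: (1 A1)
      from less.prems(2)[unfolded TLam] show ?thesis
      proof (cases rule: par_TLamE)
        case (1 A2)
        with IH[of A A1 A2] M1 TLam show ?thesis by (auto intro: par_TLam)
      next
        case (2 K)
        with eta M1 show ?thesis by blast
      qed
    next
      case M1: (2 K)
      from less.prems(2)[unfolded TLam] show ?thesis
      proof (cases rule: par_TLamE)
        case (1 A2)
        with eta M1 show ?thesis by blast
      next
        case (2 K2)
        with M1 have "K2 = K" by (auto dest: ren_tm_inj)
        with IH[of K M1 M2] 2 M1 TLam show ?thesis by auto
      qed
    qed
  next
    case (App F N)
    have beta: "joins (App F1 N1) (inst_tm A2 N2)"
      if "F \<Rrightarrow> F1" "N \<Rrightarrow> N1" "F = Lam any A" "A \<Rrightarrow> A2" "N \<Rrightarrow> N2" for F1 N1 A A2 N2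
    proof -
      from that(1)[unfolded that(3)] show ?thesis
      proof (cases rule: par_LamE)
        case (1 A1)
        from IH[of A A1 A2] IH[of N N1 N2] 1 that App obtain P Q
          where "A1 \<Rrightarrow> P" "A2 \<Rrightarrow> P" "N1 \<Rrightarrow> Q" "N2 \<Rrightarrow> Q" by auto
        with 1 show ?thesis by (auto intro: par_beta par_inst)
      next
        case (2 K)
        \<comment> \<open>Here \<open>A\<close> is the shifted \<open>K\<close> applied to variable
          0, so \<open>inst_tm A N\<close> is \<open>App K N\<close>. Both reducts of
          \<open>M\<close> are reducts of this smaller term.\<close>
        have "App K N \<Rrightarrow> App F1 N1" using 2 that by (auto intro: par_App)
        moreover have "inst_tm A N \<Rrightarrow> inst_tm A2 N2" using that by (auto intro: par_inst)
        ultimately show ?thesis using IH[of "App K N"] 2 that App by auto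
      qed
    qed
    from less.prems(1)[unfolded App] show ?thesis
    proof (cases rule: par_AppE)
      case M1: (1 F1 N1)
      from less.prems(2)[unfolded App] show ?thesis
      proof (cases rule: par_AppE)
        case (1 F2 N2)
        with IH[of F F1 F2] IH[of N N1 N2] M1 App show ?thesis by (auto intro: par_App)
      next
        case (2 A A2 N2)
        with beta M1 show ?thesis by blast
      qed
    next
      case M1: (2 A A1 N1)
      from less.prems(2)[unfolded App] show ?thesis
      proof (cases rule: par_AppE)
        case (1 F2 N2)
        with beta M1 show ?thesis by blast
      next
        case (2 A' A2 N2)
        with IH[of A A1 A2] IH[of N N1 N2] M1 App obtain P Q
          where "A1 \<Rrightarrow> P" "A2 \<Rrightarrow> P" "N1 \<Rrightarrow> Q" "N2 \<Rrightarrow> Q" by auto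
        with 2 M1 show ?thesis by (auto intro: par_inst)
      qed
    qed
  next
    case (TApp F \<sigma>)
    have beta: "joins (TApp F1 \<sigma>) (inst_tm_ty A2 \<sigma>)"
      if "F \<Rrightarrow> F1" "F = TLam A" "A \<Rrightarrow> A2" for F1 A A2
    proof -
      from that(1)[unfolded that(2)] show ?thesis
      proof (cases rule: par_TLamE)
        case (1 A1)
        from IH[of A A1 A2] 1 that TApp obtain P where "A1 \<Rrightarrow> P" "A2 \<Rrightarrow> P" by auto
        with 1 show ?thesis by (auto intro: par_tbeta par_inst)
      next
        case (2 K)
        have "TApp K \<sigma> \<Rrightarrow> TApp F1 \<sigma>" using 2 that by (auto intro: par_TApp)
        moreover have "inst_tm_ty A \<sigma> \<Rrightarrow> inst_tm_ty A2 \<sigma>" using that by (auto intro: par_inst)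
        ultimately show ?thesis using IH[of "TApp K \<sigma>"] 2 that TApp by auto
      qed
    qed
    from less.prems(1)[unfolded TApp] show ?thesis
    proof (cases rule: par_TAppE)
      case M1: (1 F1)
      from less.prems(2)[unfolded TApp] show ?thesis
      proof (cases rule: par_TAppE)
        case (1 F2)
        with IH[of F F1 F2] M1 TApp show ?thesis by (auto intro: par_TApp)
      next
        case (2 A A2)
        with beta M1 show ?thesis by blast
      qed
    next
      case M1: (2 A A1)
      from less.prems(2)[unfolded TApp] show ?thesis
      proof (cases rule: par_TAppE)
        case (1 F2)
        with beta M1 show ?thesis by blast
      next
        case (2 A' A2)
        with IH[of A A1 A2] M1 TApp obtain P where "A1 \<Rrightarrow> P" "A2 \<Rrightarrow> P" by auto
        with 2 M1 show ?thesis by (auto intro: par_inst)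
      qed
    qed
  qed
qed

section \<open>Confluence of many-step reduction and its consequences\<close>

lemma pars_strip:
  assumes "par\<^sup>*\<^sup>* M M1" "M \<Rrightarrow> M2"
  shows "\<exists>P. M1 \<Rrightarrow> P \<and> par\<^sup>*\<^sup>* M2 P"
  using assms
proof (induction rule: rtranclp_induct)
  case (step A B)
  then obtain P where "A \<Rrightarrow> P" "par\<^sup>*\<^sup>* M2 P" by blast
  moreover from par_diamond[OF step(2) this(1)] obtain Q where "B \<Rrightarrow> Q" "P \<Rrightarrow> Q" by blast
  ultimately show ?case by (meson rtranclp.rtrancl_into_rtrancl)
qed blast

lemma pars_confluent:
  assumes "par\<^sup>*\<^sup>* M M1" "par\<^sup>*\<^sup>* M M2"
  shows "\<exists>P. par\<^sup>*\<^sup>* M1 P \<and> par\<^sup>*\<^sup>* M2 P"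
  using assms(2,1)
proof (induction rule: rtranclp_induct)
  case (step A B)
  then obtain P where "par\<^sup>*\<^sup>* M1 P" "par\<^sup>*\<^sup>* A P" by blast
  moreover from pars_strip[OF this(2) step(2)] obtain Q where "P \<Rrightarrow> Q" "par\<^sup>*\<^sup>* B Q" by blast
  ultimately show ?case by (meson rtranclp.rtrancl_into_rtrancl)
qed blast

lemma pars_cong:
  assumes "par\<^sup>*\<^sup>* M M'" "\<And>A B. A \<Rrightarrow> B \<Longrightarrow> f A \<Rrightarrow> f B"
  shows "par\<^sup>*\<^sup>* (f M) (f M')"
  using assms(1) by (induction rule: rtranclp_induct) (auto intro: assms(2) rtranclp.rtrancl_into_rtrancl)

lemma pars_lift:
  assumes "par\<^sup>*\<^sup>* (ren_tm q r M) P"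
  shows "\<exists>M'. par\<^sup>*\<^sup>* M M' \<and> P = ren_tm q r M'"
  using assms
proof (induction rule: rtranclp_induct)
  case (step A B)
  then show ?case using par_lift by (metis rtranclp.rtrancl_into_rtrancl)
qed blast

lemma pars_Var: "par\<^sup>*\<^sup>* (Var n) P \<Longrightarrow> P = Var n"
  by (induction rule: rtranclp_induct) (auto elim: par_VarE)

text \<open>Each rule of parallel reduction leaves only \<open>any\<close> as annotation, hence the
  last step yields an erased term. Erased terms are the ones on which reflexivity is
  available.\<close>

lemma pars_erased: "par\<^sup>*\<^sup>* (erase M) P \<Longrightarrow> erase P = P"
proof -
  have "erase A = A" if "B \<Rrightarrow> A" for A B
    using that by induction (simp_all add: erase_inst)
  moreover have "erase (erase M) = erase M" by (induction M) simp_all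
  moreover assume "par\<^sup>*\<^sup>* (erase M) P"
  ultimately show ?thesis by (auto elim: rtranclp.cases)
qed

text \<open>The two components are reduced one after the other, each time with the other one held
  fixed by reflexivity.\<close>

lemma pars_App:
  assumes "par\<^sup>*\<^sup>* (erase M) M'" "par\<^sup>*\<^sup>* (erase N) N'"
  shows "par\<^sup>*\<^sup>* (App (erase M) (erase N)) (App M' N')"
proof -
  have "N' \<Rrightarrow> N'" using par_erase[of N'] pars_erased[OF assms(2)] by simp
  then have "par\<^sup>*\<^sup>* (App (erase M) N') (App M' N')"
    using pars_cong[OF assms(1), of "\<lambda>A. App A N'"] by (simp add: par_App)
  moreover have "par\<^sup>*\<^sup>* (App (erase M) (erase N)) (App (erase M) N')"
    using pars_cong[OF assms(2), of "App (erase M)"] by (simp add: par_App par_erase)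
  ultimately show ?thesis by simp
qed

text \<open>The Church-Rosser property after erasure: each beta or eta axiom is a single parallel
  step between erased terms, and transitivity is confluence.\<close>

lemma beta_eta_eq_joinable:
  assumes "M =\<^sub>\<beta>\<^sub>\<eta> N"
  shows "\<exists>P. par\<^sup>*\<^sup>* (erase M) P \<and> par\<^sup>*\<^sup>* (erase N) P"
  using assms
proof (induction rule: beta_eta_eq.induct)
  case (beta \<sigma> M N)
  have "erase (App (Lam \<sigma> M) N) \<Rrightarrow> erase (inst_tm M N)"
    by (simp add: erase_inst par_beta par_erase)
  then show ?case by blast
next
  case (tbeta M \<sigma>)
  have "erase (TApp (TLam M) \<sigma>) \<Rrightarrow> erase (inst_tm_ty M \<sigma>)"
    by (simp add: erase_inst par_tbeta par_erase)
  then show ?case by blast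
next
  case (eta \<sigma> M)
  have "erase (Lam \<sigma> (App (ren_tm id Suc M) (Var 0))) \<Rrightarrow> erase M"
    by (simp add: erase_ren par_eta par_erase)
  then show ?case by blast
next
  case (teta M)
  have "erase (TLam (TApp (ren_tm Suc id M) (TVar 0))) \<Rrightarrow> erase M"
    by (simp add: erase_ren par_teta par_erase)
  then show ?case by blast
next
  case (trans M N P)
  then obtain Q R where "par\<^sup>*\<^sup>* (erase M) Q" "par\<^sup>*\<^sup>* (erase N) Q"
    "par\<^sup>*\<^sup>* (erase N) R" "par\<^sup>*\<^sup>* (erase P) R" by blast
  moreover from pars_confluent[OF this(2,3)] obtain S
    where "par\<^sup>*\<^sup>* Q S" "par\<^sup>*\<^sup>* R S" by blast
  ultimately show ?case by (meson rtranclp_trans)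
next
  case (cong_Lam M M' \<sigma>)
  then show ?case using pars_cong[where f = "Lam any", OF _ par_Lam] by auto
next
  case (cong_App M M' N N')
  then show ?case using pars_App by (auto, blast)
next
  case (cong_TLam M M')
  then show ?case using pars_cong[where f = TLam, OF _ par_TLam] by auto
next
  case (cong_TApp M M' \<sigma>)
  then show ?case using pars_cong[where f = "\<lambda>M. TApp M \<sigma>", OF _ par_TApp] by auto
qed blast+

text \<open>A variable has no other reduct, so the common reduct is the variable itself.\<close>

lemma beta_eta_eq_Var:
  assumes "M =\<^sub>\<beta>\<^sub>\<eta> Var x"
  shows "par\<^sup>*\<^sup>* (erase M) (Var x)"
  using beta_eta_eq_joinable[OF assms] pars_Var by auto


subsection \<open>Typing closed under eta\<close>

text \<open>
  Once annotations are erased, the eta rule for type abstraction does not preserve types. The last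
  two rules restore subject reduction by decree; they add nothing for abstraction-free terms.
\<close>

inductive eta_typing :: "env \<Rightarrow> tm \<Rightarrow> ty \<Rightarrow> bool"  (\<open>_ \<turnstile>\<^sub>\<eta> _ : _\<close> [50, 50, 50] 50) where
  E_Var: "E n = Some \<sigma> \<Longrightarrow> E \<turnstile>\<^sub>\<eta> Var n : \<sigma>"
| E_Lam: "push \<sigma> E \<turnstile>\<^sub>\<eta> M : \<tau> \<Longrightarrow> E \<turnstile>\<^sub>\<eta> Lam any M : \<sigma> \<rightarrow>\<^sub>F \<tau>"
| E_App: "E \<turnstile>\<^sub>\<eta> M : \<sigma> \<rightarrow>\<^sub>F \<tau> \<Longrightarrow> E \<turnstile>\<^sub>\<eta> N : \<sigma> \<Longrightarrow> E \<turnstile>\<^sub>\<eta> App M N : \<tau>"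
| E_TLam: "shift_env E \<turnstile>\<^sub>\<eta> M : \<tau> \<Longrightarrow> E \<turnstile>\<^sub>\<eta> TLam M : All \<tau>"
| E_TApp: "E \<turnstile>\<^sub>\<eta> M : All \<tau> \<Longrightarrow> E \<turnstile>\<^sub>\<eta> TApp M \<sigma> : inst_ty \<tau> \<sigma>"
| E_eta: "push \<sigma> E \<turnstile>\<^sub>\<eta> App (ren_tm id Suc M) (Var 0) : \<tau> \<Longrightarrow> E \<turnstile>\<^sub>\<eta> M : \<sigma> \<rightarrow>\<^sub>F \<tau>"
| E_teta: "shift_env E \<turnstile>\<^sub>\<eta> TApp (ren_tm Suc id M) (TVar 0) : \<tau> \<Longrightarrow> E \<turnstile>\<^sub>\<eta> M : All \<tau>"

lemma typing_erase: "E \<turnstile> M : \<tau> \<Longrightarrow> E \<turnstile>\<^sub>\<eta> erase M : \<tau>"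
  by (induction rule: typing.induct) (auto intro: E_Var E_Lam E_App E_TLam E_TApp)

section \<open>Stability of typing under renaming and substitution\<close>

lemma push_simps [simp]: "push \<sigma> E 0 = Some \<sigma>" "push \<sigma> E (Suc n) = E n"
  by (simp_all add: push_def)

text \<open>Only one direction is demanded, so that \<open>E'\<close> may declare further variables
  and typing along a renaming includes weakening.\<close>

definition ren_env :: "(nat \<Rightarrow> nat) \<Rightarrow> (nat \<Rightarrow> nat) \<Rightarrow> env \<Rightarrow> env \<Rightarrow> bool" where
  "ren_env q r E E' \<longleftrightarrow> (\<forall>n \<sigma>. E n = Some \<sigma> \<longrightarrow> E' (r n) = Some (ren_ty q \<sigma>))"

lemma ren_env_push: "ren_env q r E E' \<Longrightarrow> ren_env q (up_ren r) (push \<sigma> E) (push (ren_ty q \<sigma>) E')"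
  by (auto simp: ren_env_def push_def up_ren_def split: nat.splits)

lemma ren_env_shift: "ren_env q r E E' \<Longrightarrow> ren_env (up_ren q) r (shift_env E) (shift_env E')"
  by (auto simp: ren_env_def shift_env_def ren_ren_ty)

lemma eta_typing_ren:
  assumes "E \<turnstile>\<^sub>\<eta> M : \<tau>" "ren_env q r E E'"
  shows "E' \<turnstile>\<^sub>\<eta> ren_tm q r M : ren_ty q \<tau>"
  using assms
proof (induction arbitrary: q r E' rule: eta_typing.induct)
  case (E_Var E n \<sigma>)
  then show ?case by (auto simp: ren_env_def intro: eta_typing.E_Var)
next
  case (E_Lam \<sigma> E M \<tau>)
  show ?case by (simp add: eta_typing.E_Lam E_Lam.IH ren_env_push E_Lam.prems)
next
  case (E_App E M \<sigma> \<tau> N)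
  then show ?case by (fastforce intro: eta_typing.E_App)
next
  case (E_TLam E M \<tau>)
  show ?case by (simp add: eta_typing.E_TLam E_TLam.IH ren_env_shift E_TLam.prems)
next
  case (E_TApp E M \<tau> \<sigma>)
  then show ?case by (simp add: ren_inst_ty eta_typing.E_TApp)
next
  case (E_eta \<sigma> E M \<tau>)
  from E_eta.IH[OF ren_env_push[OF E_eta.prems]] show ?case
    by (auto simp: ren_tm_shift intro: eta_typing.E_eta)
next
  case (E_teta E M \<tau>)
  from E_teta.IH[OF ren_env_shift[OF E_teta.prems]] show ?case
    by (auto simp: ren_tm_shift intro: eta_typing.E_teta)
qed

definition subst_env :: "(nat \<Rightarrow> ty) \<Rightarrow> (nat \<Rightarrow> tm) \<Rightarrow> env \<Rightarrow> env \<Rightarrow> bool" where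
  "subst_env \<theta> s E E' \<longleftrightarrow> (\<forall>n \<sigma>. E n = Some \<sigma> \<longrightarrow> E' \<turnstile>\<^sub>\<eta> s n : subst_ty \<theta> \<sigma>)"

lemma subst_env_push:
  assumes "subst_env \<theta> s E E'"
  shows "subst_env \<theta> (up_tm s) (push \<sigma> E) (push (subst_ty \<theta> \<sigma>) E')"
  unfolding subst_env_def
proof (intro allI impI)
  fix n \<upsilon>
  assume n: "push \<sigma> E n = Some \<upsilon>"
  have "ren_env id Suc E' (push (subst_ty \<theta> \<sigma>) E')" by (simp add: ren_env_def)
  from eta_typing_ren[OF _ this] n assms
  show "push (subst_ty \<theta> \<sigma>) E' \<turnstile>\<^sub>\<eta> up_tm s n : subst_ty \<theta> \<upsilon>"
    by (cases n) (fastforce simp: subst_env_def intro: E_Var)+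
qed

lemma subst_env_shift:
  assumes "subst_env \<theta> s E E'"
  shows "subst_env (up_ty \<theta>) (\<lambda>n. ren_tm Suc id (s n)) (shift_env E) (shift_env E')"
  unfolding subst_env_def
proof (intro allI impI)
  fix n \<upsilon>
  assume "shift_env E n = Some \<upsilon>"
  then obtain \<sigma> where \<sigma>: "E n = Some \<sigma>" "\<upsilon> = ren_ty Suc \<sigma>" by (auto simp: shift_env_def)
  have "ren_env Suc id E' (shift_env E')" by (simp add: ren_env_def shift_env_def)
  from eta_typing_ren[OF _ this] \<sigma> assms
  show "shift_env E' \<turnstile>\<^sub>\<eta> ren_tm Suc id (s n) : subst_ty (up_ty \<theta>) \<upsilon>"
    by (fastforce simp: subst_env_def subst_ren_ty ren_subst_ty)
qed

lemma eta_typing_subst: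
  assumes "E \<turnstile>\<^sub>\<eta> M : \<tau>" "subst_env \<theta> s E E'"
  shows "E' \<turnstile>\<^sub>\<eta> subst_tm \<theta> s M : subst_ty \<theta> \<tau>"
  using assms
proof (induction arbitrary: \<theta> s E' rule: eta_typing.induct)
  case (E_Var E n \<sigma>)
  then show ?case by (auto simp: subst_env_def)
next
  case (E_Lam \<sigma> E M \<tau>)
  show ?case by (simp add: eta_typing.E_Lam E_Lam.IH subst_env_push E_Lam.prems)
next
  case (E_App E M \<sigma> \<tau> N)
  then show ?case by (fastforce intro: eta_typing.E_App)
next
  case (E_TLam E M \<tau>)
  show ?case by (simp add: eta_typing.E_TLam E_TLam.IH subst_env_shift E_TLam.prems)
next
  case (E_TApp E M \<tau> \<sigma>)
  then show ?case by (simp add: subst_inst_ty eta_typing.E_TApp)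
next
  case (E_eta \<sigma> E M \<tau>)
  from E_eta.IH[OF subst_env_push[OF E_eta.prems]] show ?case
    by (auto simp: subst_tm_shift intro: eta_typing.E_eta)
next
  case (E_teta E M \<tau>)
  from E_teta.IH[OF subst_env_shift[OF E_teta.prems]] show ?case
    by (auto simp: subst_tm_shift intro: eta_typing.E_teta)
qed

lemma eta_typing_inst:
  assumes "push \<sigma> E \<turnstile>\<^sub>\<eta> M : \<tau>" "E \<turnstile>\<^sub>\<eta> N : \<sigma>"
  shows "E \<turnstile>\<^sub>\<eta> inst_tm M N : \<tau>"
proof -
  have "subst_env TVar (case_nat N Var) (push \<sigma> E) E"
    using assms(2) by (auto simp: subst_env_def push_def intro: E_Var split: nat.splits)
  from eta_typing_subst[OF assms(1) this] show ?thesis by (simp add: inst_tm_def)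
qed

lemma eta_typing_inst_ty:
  assumes "shift_env E \<turnstile>\<^sub>\<eta> M : \<tau>"
  shows "E \<turnstile>\<^sub>\<eta> inst_tm_ty M \<sigma> : inst_ty \<tau> \<sigma>"
proof -
  have "subst_env (case_nat \<sigma> TVar) Var (shift_env E) E"
    by (auto simp: subst_env_def shift_env_def subst_ren_ty intro: E_Var)
  from eta_typing_subst[OF assms this] show ?thesis by (simp add: inst_tm_ty_def inst_ty_def)
qed

text \<open>
  The generation properties for \<open>Lam\<close> and \<open>TLam\<close> are proved simultaneously with subject
  reduction: when \<open>Lam any A\<close> is typed by \<open>E_eta\<close>, the premise types the redex
  \<open>App (Lam any A) (Var 0)\<close>, with \<open>A\<close> shifted, which reduces to \<open>A\<close>.
\<close>

lemma subject_reduction_gen: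
  assumes "E \<turnstile>\<^sub>\<eta> M : \<tau>"
  shows "(\<forall>M'. M \<Rrightarrow> M' \<longrightarrow> E \<turnstile>\<^sub>\<eta> M' : \<tau>)
    \<and> (\<forall>A A' \<tau>1 \<tau>2. M = Lam any A \<longrightarrow> \<tau> = \<tau>1 \<rightarrow>\<^sub>F \<tau>2 \<longrightarrow> A \<Rrightarrow> A' \<longrightarrow> push \<tau>1 E \<turnstile>\<^sub>\<eta> A' : \<tau>2)
    \<and> (\<forall>A A' \<tau>1. M = TLam A \<longrightarrow> \<tau> = All \<tau>1 \<longrightarrow> A \<Rrightarrow> A' \<longrightarrow> shift_env E \<turnstile>\<^sub>\<eta> A' : \<tau>1)"
  using assms
proof (induction rule: eta_typing.induct)
  case (E_Var E n \<sigma>)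
  then show ?case by (auto elim!: par_VarE intro: eta_typing.E_Var)
next
  case (E_Lam \<sigma> E M \<tau>)
  have "E \<turnstile>\<^sub>\<eta> M' : \<sigma> \<rightarrow>\<^sub>F \<tau>" if "Lam any M \<Rrightarrow> M'" for M'
    using that
  proof (cases rule: par_LamE)
    case (1 A)
    with E_Lam.IH show ?thesis by (auto intro: eta_typing.E_Lam)
  next
    case (2 K)
    \<comment> \<open>\<open>M\<close> is the shifted \<open>K\<close> applied to variable 0, so it
      reduces to the expansion of \<open>M'\<close>. The induction hypothesis types this expansion
      and \<open>E_eta\<close> passes the type on to \<open>M'\<close>.\<close>
    then have "M \<Rrightarrow> App (ren_tm id Suc M') (Var 0)" by (auto intro: par_App par_Var par_ren)
    with E_Lam.IH show ?thesis by (auto intro: eta_typing.E_eta)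
  qed
  with E_Lam.IH show ?case by auto
next
  case (E_App E M \<sigma> \<tau> N)
  have "E \<turnstile>\<^sub>\<eta> P : \<tau>" if "App M N \<Rrightarrow> P" for P
    using that
  proof (cases rule: par_AppE)
    case (1 M' N')
    with E_App.IH show ?thesis by (auto intro: eta_typing.E_App)
  next
    case (2 A A' N')
    with E_App.IH show ?thesis by (auto intro: eta_typing_inst)
  qed
  then show ?case by auto
next
  case (E_TLam E M \<tau>)
  have "E \<turnstile>\<^sub>\<eta> M' : All \<tau>" if "TLam M \<Rrightarrow> M'" for M'
    using that
  proof (cases rule: par_TLamE)
    case (1 A)
    with E_TLam.IH show ?thesis by (auto intro: eta_typing.E_TLam)
  next
    case (2 K)
    then have "M \<Rrightarrow> TApp (ren_tm Suc id M') (TVar 0)" by (auto intro: par_TApp par_ren)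
    with E_TLam.IH show ?thesis by (auto intro: eta_typing.E_teta)
  qed
  with E_TLam.IH show ?case by auto
next
  case (E_TApp E M \<tau> \<sigma>)
  have "E \<turnstile>\<^sub>\<eta> P : inst_ty \<tau> \<sigma>" if "TApp M \<sigma> \<Rrightarrow> P" for P
    using that
  proof (cases rule: par_TAppE)
    case (1 M')
    with E_TApp.IH show ?thesis by (auto intro: eta_typing.E_TApp)
  next
    case (2 A A')
    with E_TApp.IH show ?thesis by (auto intro: eta_typing_inst_ty)
  qed
  then show ?case by auto
next
  case (E_eta \<sigma> E M \<tau>)
  have "E \<turnstile>\<^sub>\<eta> M' : \<sigma> \<rightarrow>\<^sub>F \<tau>" if "M \<Rrightarrow> M'" for M'
    using that E_eta.IH by (auto intro!: eta_typing.E_eta par_App par_Var par_ren)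
  moreover have "push \<sigma> E \<turnstile>\<^sub>\<eta> A' : \<tau>" if "M = Lam any A" "A \<Rrightarrow> A'" for A A'
  proof -
    have "App (ren_tm id Suc M) (Var 0) \<Rrightarrow> A'"
      using par_beta[OF par_ren[OF that(2), of id "up_ren Suc"] par_Var, of 0] that(1) by simp
    with E_eta.IH show ?thesis by simp
  qed
  ultimately show ?case by auto
next
  case (E_teta E M \<tau>)
  have "E \<turnstile>\<^sub>\<eta> M' : All \<tau>" if "M \<Rrightarrow> M'" for M'
    using that E_teta.IH by (auto intro!: eta_typing.E_teta par_TApp par_ren)
  moreover have "shift_env E \<turnstile>\<^sub>\<eta> A' : \<tau>" if "M = TLam A" "A \<Rrightarrow> A'" for A A'
  proof -
    have "TApp (ren_tm Suc id M) (TVar 0) \<Rrightarrow> A'"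
      using par_tbeta[OF par_ren[OF that(2), of "up_ren Suc" id], of "TVar 0"] that(1) by simp
    with E_teta.IH show ?thesis by simp
  qed
  ultimately show ?case by auto
qed

lemma subject_reduction: "par\<^sup>*\<^sup>* M M' \<Longrightarrow> E \<turnstile>\<^sub>\<eta> M : \<tau> \<Longrightarrow> E \<turnstile>\<^sub>\<eta> M' : \<tau>"
  by (induction rule: rtranclp_induct) (simp_all add: subject_reduction_gen)

section \<open>Conservativity over ordinary typing for terms without abstractions\<close>

text \<open>The class contains the variables and is closed under the shifted applications in the
  premises of \<open>E_eta\<close> and \<open>E_teta\<close>, so an induction over
  \<open>eta_typing\<close> stays inside it.\<close>

primrec abs_free :: "tm \<Rightarrow> bool" where
  "abs_free (Var n) \<longleftrightarrow> True"
| "abs_free (Lam \<sigma> M) \<longleftrightarrow> False"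
| "abs_free (App M N) \<longleftrightarrow> abs_free M \<and> abs_free N"
| "abs_free (TLam M) \<longleftrightarrow> False"
| "abs_free (TApp M \<sigma>) \<longleftrightarrow> abs_free M"

lemma abs_free_ren [simp]: "abs_free (ren_tm q r M) = abs_free M"
  by (induction M) simp_all

lemma ren_ty_inj: "inj q \<Longrightarrow> ren_ty q \<sigma> = ren_ty q \<tau> \<Longrightarrow> \<sigma> = \<tau>"
  using pullback_ty[of q \<sigma> q \<tau> id id] by (auto simp: pullback_def dest: injD)

lemma ren_ty_eq_Arr:
  "ren_ty q \<sigma> = \<tau>1 \<rightarrow>\<^sub>F \<tau>2
    \<longleftrightarrow> (\<exists>\<sigma>1 \<sigma>2. \<sigma> = \<sigma>1 \<rightarrow>\<^sub>F \<sigma>2 \<and> \<tau>1 = ren_ty q \<sigma>1 \<and> \<tau>2 = ren_ty q \<sigma>2)"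
  by (cases \<sigma>) auto

lemma ren_ty_eq_All:
  "ren_ty q \<sigma> = All \<tau> \<longleftrightarrow> (\<exists>\<sigma>'. \<sigma> = All \<sigma>' \<and> \<tau> = ren_ty (up_ren q) \<sigma>')"
  by (cases \<sigma>) auto

inductive_cases typing_VarE: "E \<turnstile> Var n : \<tau>"
inductive_cases typing_AppE: "E \<turnstile> App M N : \<tau>"
inductive_cases typing_TAppE: "E \<turnstile> TApp M \<sigma> : \<tau>"

text \<open>Without abstractions a type is computed from the environment and the type arguments,
  which all lie in the image of \<open>q\<close>. It is used with one of \<open>q\<close> and
  \<open>r\<close> a shift and the other the identity, to undo an expansion.\<close>

lemma abs_free_strengthen:
  assumes "E' \<turnstile> ren_tm q r M : \<tau>'" "abs_free M" "inj q"
    "\<And>n. E' (r n) = map_option (ren_ty q) (E n)"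
  shows "\<exists>\<tau>. \<tau>' = ren_ty q \<tau> \<and> E \<turnstile> M : \<tau>"
  using assms(1,2)
proof (induction M arbitrary: \<tau>')
  case (Var n)
  then show ?case using assms(4) by (fastforce elim!: typing_VarE intro: T_Var)
next
  case (App M N)
  from App.prems(1) obtain \<sigma>
    where "E' \<turnstile> ren_tm q r M : \<sigma> \<rightarrow>\<^sub>F \<tau>'" "E' \<turnstile> ren_tm q r N : \<sigma>"
    by (auto elim: typing_AppE)
  with App.IH App.prems(2) obtain \<upsilon>1 \<upsilon>2
    where \<upsilon>: "\<sigma> \<rightarrow>\<^sub>F \<tau>' = ren_ty q \<upsilon>1" "E \<turnstile> M : \<upsilon>1" "\<sigma> = ren_ty q \<upsilon>2" "E \<turnstile> N : \<upsilon>2"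
    by (metis abs_free.simps(3))
  from \<upsilon>(1)[symmetric] obtain \<sigma>1 \<sigma>2
    where "\<upsilon>1 = \<sigma>1 \<rightarrow>\<^sub>F \<sigma>2" "\<sigma> = ren_ty q \<sigma>1" "\<tau>' = ren_ty q \<sigma>2"
    by (auto simp: ren_ty_eq_Arr)
  \<comment> \<open>Injectivity of \<open>q\<close> makes the domain of the function agree with the
    type of the argument before renaming.\<close>
  with \<upsilon> ren_ty_inj[OF assms(3)] show ?case by (blast intro: T_App)
next
  case (TApp M \<sigma>)
  from TApp.prems(1) obtain \<tau>1
    where "E' \<turnstile> ren_tm q r M : All \<tau>1" "\<tau>' = inst_ty \<tau>1 (ren_ty q \<sigma>)"
    by (auto elim: typing_TAppE)
  moreover from TApp.IH[OF this(1)] TApp.prems(2) obtain \<upsilon>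
    where "All \<tau>1 = ren_ty q \<upsilon>" "E \<turnstile> M : \<upsilon>" by auto
  moreover from this(1)[symmetric] obtain \<upsilon>' where "\<upsilon> = All \<upsilon>'" "\<tau>1 = ren_ty (up_ren q) \<upsilon>'"
    by (auto simp: ren_ty_eq_All)
  ultimately show ?case by (auto simp: ren_inst_ty[symmetric] intro: T_TApp)
qed simp_all

text \<open>In the eta cases inversion recovers a typing of the shifted term, and strengthening
  removes the shift.\<close>

lemma eta_typing_abs_free: "E \<turnstile>\<^sub>\<eta> M : \<tau> \<Longrightarrow> abs_free M \<Longrightarrow> E \<turnstile> M : \<tau>"
proof (induction rule: eta_typing.induct)
  case (E_eta \<sigma> E M \<tau>)
  then have "push \<sigma> E \<turnstile> App (ren_tm id Suc M) (Var 0) : \<tau>" by simp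
  then have "push \<sigma> E \<turnstile> ren_tm id Suc M : \<sigma> \<rightarrow>\<^sub>F \<tau>"
    by (auto elim!: typing_AppE typing_VarE)
  from abs_free_strengthen[OF this E_eta.prems] show ?case by (auto simp: option.map_ident_strong)
next
  case (E_teta E M \<tau>)
  then have "shift_env E \<turnstile> TApp (ren_tm Suc id M) (TVar 0) : \<tau>" by simp
  then obtain \<tau>1 where \<tau>1: "shift_env E \<turnstile> ren_tm Suc id M : All \<tau>1" "\<tau> = inst_ty \<tau>1 (TVar 0)"
    by (auto elim: typing_TAppE)
  from abs_free_strengthen[OF \<tau>1(1) E_teta.prems] obtain \<upsilon>
    where "All \<tau>1 = ren_ty Suc \<upsilon>" "E \<turnstile> M : \<upsilon>" by (auto simp: shift_env_def)
  moreover from this(1)[symmetric] obtain \<upsilon>' where "\<upsilon> = All \<upsilon>'" "\<tau>1 = ren_ty (up_ren Suc) \<upsilon>'"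
    by (auto simp: ren_ty_eq_All)
  ultimately show ?case using \<tau>1(2) by simp
qed (auto intro: typing.intros)

lemma eta_typing_Var: "E \<turnstile>\<^sub>\<eta> Var n : \<tau> \<Longrightarrow> E n = Some \<tau>"
  using eta_typing_abs_free[of E "Var n" \<tau>] by (auto elim: typing_VarE)


subsection \<open>Retractions\<close>

text \<open>Both directions matter below: one shows that changing the name of \<open>a\<close>
  leaves \<tau> alone, the other that it changes \<rho>.\<close>

lemma ren_ty_cong_iff: "ren_ty q \<sigma> = ren_ty q' \<sigma> \<longleftrightarrow> (\<forall>n \<in> FV_ty \<sigma>. q n = q' n)"
proof (induction \<sigma> arbitrary: q q')
  case (All \<sigma>)
  have "(\<forall>n \<in> FV_ty \<sigma>. up_ren q n = up_ren q' n) \<longleftrightarrow> (\<forall>n. Suc n \<in> FV_ty \<sigma> \<longrightarrow> q n = q' n)"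
    by (auto simp: up_ren_def split: nat.split)
  with All show ?case by simp
qed auto

theorem proposition5p3:
  fixes \<rho> \<tau> :: ty
  assumes "\<rho> \<unlhd>\<^sub>F \<tau>"
  shows "FV_ty \<rho> \<subseteq> FV_ty \<tau>"
proof
  fix a
  assume a: "a \<in> FV_ty \<rho>"
  show "a \<in> FV_ty \<tau>"
  proof (rule ccontr)
    assume a': "a \<notin> FV_ty \<tau>"
    from assms obtain E x C D where x: "E x = None" and C: "E(x \<mapsto> \<rho>) \<turnstile> C : \<tau>"
      and D: "E \<turnstile> D : \<tau> \<rightarrow>\<^sub>F \<rho>" and DC: "App D C =\<^sub>\<beta>\<^sub>\<eta> Var x"
      unfolding retract_def by (auto simp: domIff)
    \<comment> \<open>\<open>p\<close> and \<open>q\<close> differ only at \<open>a\<close>, which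
      \<open>q\<close> sends to the fresh odd index. Halving is a left inverse of both, and of the
      odd embedding used for the term variables of the coder.\<close>
    define h :: "nat \<Rightarrow> nat" where "h n = n div 2" for n
    define p :: "nat \<Rightarrow> nat" where "p n = 2 * n" for n
    define q :: "nat \<Rightarrow> nat" where "q n = (if n = a then 2 * n + 1 else 2 * n)" for n
    \<comment> \<open>Two environments interleaved: even indices serve the decoder, odd indices the
      coder together with its \<open>x\<close>.\<close>
    define E' where "E' n = (if even n then map_option (ren_ty p) (E (h n))
      else map_option (ren_ty q) ((E(x \<mapsto> \<rho>)) (h n)))" for n
    define D' where "D' = ren_tm p p (erase D)"
    define C' where "C' = ren_tm q (\<lambda>n. 2 * n + 1) (erase C)"
    have h: "h (p n) = n" "h (2 * n) = n" "h (Suc (2 * n)) = n" "h (q n) = n" for n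
      by (simp_all add: h_def p_def q_def)
    have "E' \<turnstile>\<^sub>\<eta> D' : ren_ty p (\<tau> \<rightarrow>\<^sub>F \<rho>)"
      unfolding D'_def
      by (rule eta_typing_ren[OF typing_erase[OF D]]) (simp add: ren_env_def E'_def h p_def)
    moreover have "E' \<turnstile>\<^sub>\<eta> C' : ren_ty q \<tau>"
      unfolding C'_def
      by (rule eta_typing_ren[OF typing_erase[OF C]]) (simp add: ren_env_def E'_def h p_def)
    \<comment> \<open>The only use of the assumption that \<open>a\<close> is not free in \<tau>:
      the renamed decoder still accepts the renamed coder.\<close>
    moreover have "ren_ty q \<tau> = ren_ty p \<tau>"
      unfolding ren_ty_cong_iff using a' by (auto simp: p_def q_def)
    ultimately have typed: "E' \<turnstile>\<^sub>\<eta> App D' C' : ren_ty p \<rho>"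
      by (auto intro: E_App)
    \<comment> \<open>Merging the copies by \<open>h\<close> is not injective, but
      \<open>pars_lift\<close> holds for arbitrary renamings.\<close>
    have "erase (App D C) = ren_tm h h (App D' C')"
      by (simp add: D'_def C'_def ren_ren_tm h)
    with beta_eta_eq_Var[OF DC] have "par\<^sup>*\<^sup>* (ren_tm h h (App D' C')) (Var x)" by simp
    then obtain P where P: "par\<^sup>*\<^sup>* (App D' C') P" "Var x = ren_tm h h P"
      using pars_lift by blast
    then obtain n where n: "P = Var n" "h n = x" by (cases P) auto
    with subject_reduction[OF P(1) typed] have "E' n = Some (ren_ty p \<rho>)"
      by (simp add: eta_typing_Var)
    \<comment> \<open>The index \<open>n\<close> is half-mapped to \<open>x\<close>, and
      \<open>E x = None\<close> excludes the even copy. The odd copy is declared with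
      \<open>ren_ty q\<close> of \<rho>, whereas subject reduction gives \<open>ren_ty p\<close> of
      \<rho>.\<close>
    with x n have "ren_ty q \<rho> = ren_ty p \<rho>"
      by (auto simp: E'_def split: if_splits)
    with a show False unfolding ren_ty_cong_iff by (auto simp: p_def q_def)
  qed
qed

end
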